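(* Let $n\ge1$. The family of regular images of the closed unit ball $\overline{B}_n$ is a subfamily of the family of regular images of $\mathbb{R}^n$; that is, if $S\subset\mathbb{R}^p$ satisfies $S=f(\overline{B}_n)$ for some regular map $f:\overline{B}_n\to\mathbb{R}^p$, then there exists a regular map $g:\mathbb{R}^n\to\mathbb{R}^p$ such that $g(\mathbb{R}^n)=S$.
   Context: $\overline{B}_n$ denotes the closed unit ball of $\mathbb{R}^n$ centered at the origin. A regular map on a semialgebraic set $X\subset\mathbb{R}^m$ is a map $f=(f_1,\ldots,f_p):X\to\mathbb{R}^p$ whose components are of the form $f_k=g_k/h_k$ on $X$, where $g_k,h_k\in\mathbb{R}[x_1,\ldots,x_m]$ and $h_k$ does not vanish at any point of $X$. *)

theory Defs
  imports "HOL-Analysis.Analysis"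
begin

text \<open>
  The library predicate \<open>real_polynomial_function\<close> is the least set of functions that contains the
  constants and the (bounded) linear forms and is closed under sums and products. On
  \<open>real ^ 'm\<close> every linear form is a real linear combination of the coordinate functions, so these
  are exactly the functions given by polynomials with real coefficients in the coordinates.
  The polynomials in numerator and denominator may differ from component to component, but for
  each component a single fraction represents it on all of \<open>X\<close>.
\<close>

definition regular_map_on :: "(real ^ 'm) set \<Rightarrow> (real ^ 'm \<Rightarrow> real ^ 'p) \<Rightarrow> bool" where
  "regular_map_on X f \<longleftrightarrow>
     (\<forall>k. \<exists>g h. real_polynomial_function g \<and> real_polynomial_function h \<and>
        (\<forall>x\<in>X. h x \<noteq> 0 \<and> f x $ k = g x / h x))"

end

theory Submission
  imports Defs
begin

text \<open>
  The closed unit ball is itself a regular image of the whole space: \<open>x \<mapsto> 2x / (1 + \<parallel>x\<parallel>\<^sup>2)\<close> is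
  defined everywhere, has norm at most \<open>1\<close> because \<open>2t \<le> 1 + t\<^sup>2\<close>, and attains every point of
  the ball, since on each ray it restricts to \<open>t \<mapsto> 2t / (1 + t\<^sup>2)\<close>, which maps \<open>[0, 1]\<close> onto
  itself (lemma \<open>squash_image\<close>). Precomposing a regular map on the ball with this map thus keeps
  the image, and it remains regular because substituting fractions with a common denominator into
  a polynomial gives a fraction whose denominator is a power of it
  (lemma \<open>polynomial_of_fraction\<close>).
\<close>

definition squash :: "'a::real_normed_vector \<Rightarrow> 'a" where
  "squash x = (2 *\<^sub>R x) /\<^sub>R (1 + (norm x)\<^sup>2)"

lemma one_plus_norm_square_pos: "1 + (norm x)\<^sup>2 > 0"
  by (simp add: add_pos_nonneg)

lemma norm_squash_le_1: "norm (squash x) \<le> 1"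
proof -
  have "0 \<le> (norm x - 1)\<^sup>2" by simp
  then have "2 * norm x \<le> 1 + (norm x)\<^sup>2"
    by (simp add: power2_diff)
  moreover have "norm (squash x) = 2 * norm x / (1 + (norm x)\<^sup>2)"
    using one_plus_norm_square_pos[of x] by (simp add: squash_def field_simps)
  ultimately show ?thesis
    using one_plus_norm_square_pos[of x] by (simp add: divide_le_eq)
qed

text \<open>
  Along a ray, a preimage of the norm \<open>r\<close> is the smaller root \<open>t = (1 - sqrt (1 - r\<^sup>2)) / r\<close> of
  \<open>2t = r (1 + t\<^sup>2)\<close>; the form \<open>r / (1 + sqrt (1 - r\<^sup>2))\<close> of that root also covers \<open>r = 0\<close>.
\<close>

lemma squash_preimage:
  assumes "norm y \<le> 1"
  shows "squash (y /\<^sub>R (1 + sqrt (1 - (norm y)\<^sup>2))) = y"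
proof -
  define s where "s = sqrt (1 - (norm y)\<^sup>2)"
  have "(norm y)\<^sup>2 \<le> 1"
    using assms by (simp add: power_le_one)
  then have s: "s \<ge> 0" "(norm y)\<^sup>2 = (1 + s) * (1 - s)"
    by (simp_all add: s_def algebra_simps power2_eq_square[symmetric])
  have "(norm (y /\<^sub>R (1 + s)))\<^sup>2 = (norm y)\<^sup>2 / (1 + s)\<^sup>2"
    using s(1) by (simp add: power_mult_distrib power_divide divide_inverse power_inverse)
  also have "\<dots> = (1 - s) / (1 + s)"
    using s(1) unfolding s(2) by (simp add: power2_eq_square)
  finally have "1 + (norm (y /\<^sub>R (1 + s)))\<^sup>2 = 2 / (1 + s)"
    using s(1) by (simp add: field_simps)
  then have "squash (y /\<^sub>R (1 + s)) = y"
    using s(1) by (simp add: squash_def)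
  then show ?thesis by (simp add: s_def)
qed

lemma squash_image: "range squash = cball 0 1"
proof
  show "range squash \<subseteq> cball 0 1"
    using norm_squash_le_1 by auto
  show "cball 0 1 \<subseteq> range squash"
    using squash_preimage by (metis mem_cball_0 rangeI subsetI)
qed

text \<open>
  Multiplying by \<open>q\<^sup>k\<close> clears all denominators once \<open>k\<close> is at least the degree of \<open>p\<close>.
  Following the construction of \<open>p\<close> from linear forms and constants produces such a bound, by
  adding exponents at every sum and product, without a notion of degree.
\<close>

lemma polynomial_of_fraction:
  fixes u :: "'a::real_normed_vector \<Rightarrow> 'b::real_normed_vector"
  assumes "real_polynomial_function p" and u: "polynomial_function u"
    and q: "real_polynomial_function q" "\<And>x. q x \<noteq> 0"
  shows "\<exists>P k. real_polynomial_function P \<and> (\<forall>x. p (u x /\<^sub>R q x) = P x / q x ^ k)"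
  using assms(1)
proof induction
  case (linear l)
  then have "real_polynomial_function (\<lambda>x. l (u x))"
    using u by (simp add: polynomial_function_def o_def)
  moreover have "l (u x /\<^sub>R q x) = l (u x) / q x ^ 1" for x
    using linear by (simp add: bounded_linear.linear linear_scale divide_inverse mult.commute)
  ultimately show ?case by blast
next
  case (const c)
  have "c = c / q x ^ 0" for x by simp
  then show ?case using real_polynomial_function.intros(2) by blast
next
  case (add f g)
  then obtain P k Q m where
    P: "real_polynomial_function P" "\<And>x. f (u x /\<^sub>R q x) = P x / q x ^ k" and
    Q: "real_polynomial_function Q" "\<And>x. g (u x /\<^sub>R q x) = Q x / q x ^ m"
    by blast
  have "real_polynomial_function (\<lambda>x. P x * q x ^ m + Q x * q x ^ k)"
    using P(1) Q(1) q(1) by (intro real_polynomial_function.intros(3,4) real_polynomial_function_power)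
  moreover have
    "f (u x /\<^sub>R q x) + g (u x /\<^sub>R q x) = (P x * q x ^ m + Q x * q x ^ k) / q x ^ (k + m)" for x
    unfolding P(2) Q(2) using q(2)[of x] by (simp add: power_add field_simps)
  ultimately show ?case
    by (intro exI[of _ "\<lambda>x. P x * q x ^ m + Q x * q x ^ k"] exI[of _ "k + m"]) simp
next
  case (mult f g)
  then obtain P k Q m where
    P: "real_polynomial_function P" "\<And>x. f (u x /\<^sub>R q x) = P x / q x ^ k" and
    Q: "real_polynomial_function Q" "\<And>x. g (u x /\<^sub>R q x) = Q x / q x ^ m"
    by blast
  have "real_polynomial_function (\<lambda>x. P x * Q x)"
    using P(1) Q(1) by (rule real_polynomial_function.intros(4))
  then show ?case
    by (intro exI[of _ "\<lambda>x. P x * Q x"] exI[of _ "k + m"]) (simp add: P(2) Q(2) power_add)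
qed

text \<open>
  After the substitution the numerator and the denominator of a component become \<open>G / q\<^sup>i\<close> and
  \<open>H / q\<^sup>j\<close>; clearing the powers of \<open>q\<close> leaves a single fraction of polynomials on \<open>Y\<close>.
\<close>

lemma regular_map_on_compose_fraction:
  fixes f :: "real ^ 'm \<Rightarrow> real ^ 'p" and u :: "real ^ 'n \<Rightarrow> real ^ 'm"
  assumes f: "regular_map_on X f" and u: "polynomial_function u"
    and q: "real_polynomial_function q" "\<And>x. q x \<noteq> 0"
    and X: "\<And>x. x \<in> Y \<Longrightarrow> u x /\<^sub>R q x \<in> X"
  shows "regular_map_on Y (\<lambda>x. f (u x /\<^sub>R q x))"
  unfolding regular_map_on_def
proof
  fix k
  obtain g h where g: "real_polynomial_function g" and h: "real_polynomial_function h"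
    and gh: "\<And>y. y \<in> X \<Longrightarrow> h y \<noteq> 0 \<and> f y $ k = g y / h y"
    using f unfolding regular_map_on_def by metis
  obtain G i where G: "real_polynomial_function G" "\<And>x. g (u x /\<^sub>R q x) = G x / q x ^ i"
    using polynomial_of_fraction[OF g u q] by blast
  obtain H j where H: "real_polynomial_function H" "\<And>x. h (u x /\<^sub>R q x) = H x / q x ^ j"
    using polynomial_of_fraction[OF h u q] by blast
  show "\<exists>g h. real_polynomial_function g \<and> real_polynomial_function h \<and>
      (\<forall>x\<in>Y. h x \<noteq> 0 \<and> f (u x /\<^sub>R q x) $ k = g x / h x)"
  proof (intro exI conjI ballI)
    show "real_polynomial_function (\<lambda>x. G x * q x ^ j)"
      "real_polynomial_function (\<lambda>x. H x * q x ^ i)"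
      using G(1) H(1) q(1)
      by (auto intro!: real_polynomial_function.intros(4) real_polynomial_function_power)
    fix x assume "x \<in> Y"
    note eq = gh[OF X[OF this], unfolded G(2) H(2)]
    show "H x * q x ^ i \<noteq> 0"
      using eq q(2)[of x] by auto
    show "f (u x /\<^sub>R q x) $ k = (G x * q x ^ j) / (H x * q x ^ i)"
      using eq by simp
  qed
qed

theorem corollaryA2:
  fixes S :: "(real ^ 'p) set" and f :: "real ^ 'n \<Rightarrow> real ^ 'p"
  assumes "regular_map_on (cball 0 1) f"
    and "S = f ` cball 0 1"
  shows "\<exists>g :: real ^ 'n \<Rightarrow> real ^ 'p. regular_map_on UNIV g \<and> g ` UNIV = S"
proof (intro exI conjI)
  have num: "polynomial_function (\<lambda>x::real ^ 'n. 2 *\<^sub>R x)"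
    by (intro polynomial_function_cmul polynomial_function_id)
  have "real_polynomial_function (\<lambda>x::real ^ 'n. \<Sum>i\<in>UNIV. (x $ i)\<^sup>2)"
    by (intro real_polynomial_function_sum real_polynomial_function_power
        real_polynomial_function.intros(1) bounded_linear_vec_nth finite)
  then have den: "real_polynomial_function (\<lambda>x::real ^ 'n. 1 + (norm x)\<^sup>2)"
    by (intro real_polynomial_function.intros(2,3))
      (simp add: norm_vec_def L2_set_def sum_nonneg)
  have "(2 *\<^sub>R x) /\<^sub>R (1 + (norm x)\<^sup>2) \<in> cball 0 1" for x :: "real ^ 'n"
    using norm_squash_le_1[of x] by (simp only: squash_def mem_cball_0)
  then show "regular_map_on UNIV (f \<circ> squash)"
    unfolding o_def squash_def
    using one_plus_norm_square_pos
    by (intro regular_map_on_compose_fraction[OF assms(1) num den]) (auto simp: less_le)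
  show "range (f \<circ> squash) = S"
    unfolding assms(2) squash_image[symmetric] by (rule image_comp[symmetric])
qed

end
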